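(* Let $m,n,a,b\in\mathbb{Z}$ with $n\ne0$, $b\neq 0$, $\gcd(m,n)=\gcd(a,b)=1$, and consider the equation $$a^nx^nz^m=b^ny^n$$ in unknowns $x,y,z$. If this equation is partition regular over $\mathbb{N}$, then $\frac ab$ is an $\frac mn$-power in $\mathbb{Q}$. If $\frac ab$ is an $\frac mn$-power in $\mathbb{N}$, then the equation is partition regular over $\mathbb{N}$.
   Context: The equation is partition regular over $\mathbb{N}$ if for every finite coloring $c$ of $\mathbb{N}$ there are $x,y,z\in\mathbb{N}$ with $c(x)=c(y)=c(z)$ satisfying it (with $z^m$ interpreted as a rational number when $m<0$). For a prime $p$, $\nu_p:\mathbb{Q}^\times\to\mathbb{Z}$ is the $p$-adic valuation. A nonzero rational $r$ is an $\frac mn$-power in $\mathbb{Q}$ if for every prime $p$, $m$ divides $n\,\nu_p(r)$; $r$ is an $\frac mn$-power in $\mathbb{N}$ if $r=l^{m/n}$ for some $l\in\mathbb{N}$, i.e. $r>0$ and $r^n=l^m$. *)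

theory Defs
  imports Complex_Main "HOL-Computational_Algebra.Computational_Algebra"
begin

text \<open>Here \<open>\<nat>\<close> denotes the positive integers.  A finite colouring is a map on the positive
  integers with finitely many values; the value of \<open>c\<close> at \<open>0\<close> plays no role.\<close>

definition partition_regular3 :: "(nat \<Rightarrow> nat \<Rightarrow> nat \<Rightarrow> bool) \<Rightarrow> bool" where
  "partition_regular3 E \<longleftrightarrow>
     (\<forall>c :: nat \<Rightarrow> nat. finite (c ` {0<..}) \<longrightarrow>
        (\<exists>x>0. \<exists>y>0. \<exists>z>0. c x = c y \<and> c y = c z \<and> E x y z))"

text \<open>The \<open>p\<close>-adic valuation of a nonzero rational, read off from its reduced fraction.\<close>

definition padic_val :: "nat \<Rightarrow> rat \<Rightarrow> int" where
  "padic_val p r = int (multiplicity (int p) (fst (quotient_of r)))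
                 - int (multiplicity (int p) (snd (quotient_of r)))"

definition frac_power_in_Q :: "int \<Rightarrow> int \<Rightarrow> rat \<Rightarrow> bool" where
  "frac_power_in_Q m n r \<longleftrightarrow> r \<noteq> 0 \<and> (\<forall>p. prime p \<longrightarrow> m dvd n * padic_val p r)"

definition frac_power_in_N :: "int \<Rightarrow> int \<Rightarrow> rat \<Rightarrow> bool" where
  "frac_power_in_N m n r \<longleftrightarrow> r > 0 \<and> (\<exists>l::nat. l > 0 \<and> r powi n = of_nat l powi m)"

end

theory Submission imports Defs begin

text \<open>
  Necessity: comparing \<open>p\<close>-adic valuations in the equation gives
  \<open>n \<nu>(a/b) = n (\<nu>(y) - \<nu>(x)) - m \<nu>(z)\<close>, so colouring a number by its valuation
  modulo \<open>\<bar>m\<bar>\<close> forces \<open>m\<close> to divide the left-hand side (if \<open>m = 0\<close>, a modulus exceeding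
  \<open>\<bar>\<nu>(a/b)\<bar>\<close> forces \<open>\<nu>(a/b) = 0\<close>).

  Sufficiency: if \<open>(a/b)\<^sup>n = l\<^sup>m\<close>, then \<open>x = l\<^bsup>k-1\<^esup>\<close>, \<open>y = l\<^bsup>k'-1\<^esup>\<close>, \<open>z = l\<^bsup>w-1\<^esup>\<close> solve the
  equation as soon as \<open>n (k' - k) = m w\<close>. The shift by one in the exponents absorbs the
  coefficient, and one is left with a homogeneous linear equation, which is partition regular.
  For the latter, van der Waerden's theorem is replaced by a pigeonhole argument: the differences
  of a dense set \<open>A\<close> contain a dilate of \<open>{1..M}\<close>, since the translates of \<open>A\<^sup>M\<close> by multiples of
  \<open>(1, \<dots>, M)\<close> cannot all be disjoint. Either some dilated difference has the colour of \<open>A\<close>,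
  or one recurses on a dilate of \<open>{1..M}\<close> with one colour fewer.
\<close>

section \<open>A homogeneous linear equation\<close>

text \<open>Volume count: the translates of \<open>A\<close>^M by
  \<open>m * s * (1, ..., M)\<close>, for \<open>s\<close> from \<open>0\<close> to
  \<open>R\<close>, all lie in the box \<open>{1..2 * L}\<close>^M because
  \<open>m * M * R < L\<close>. Together they have \<open>Suc R * card A ^ M\<close> points, more
  than the box holds since \<open>L \<le> r * card A\<close>, so two of them meet.\<close>

lemma dilate_in_differences:
  fixes A :: "nat set" and m M r L R :: nat
  assumes A: "A \<subseteq> {1..L}" and dense: "L \<le> r * card A"
    and L: "m * M * R < L" and R: "(2 * r) ^ M \<le> R"
  shows "\<exists>e\<in>{1..R}. \<forall>j\<in>{1..M}. \<exists>x\<in>A. x + m * e * j \<in> A"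
proof -
  \<comment> \<open>A point of \<open>S\<close> is a shift \<open>s\<close> paired with a vector
    \<open>x\<close> of \<open>A\<close>^M; \<open>f\<close> performs the translation, so a
    collision of \<open>f\<close> is a common point of two translates.\<close>
  define S where "S = {0..R} \<times> (\<Pi>\<^sub>E j\<in>{1..M}. A)"
  define T where "T = (\<Pi>\<^sub>E j\<in>{1..M}. {1..2 * L})"
  define f where "f = (\<lambda>(s, x). \<lambda>j\<in>{1..M}. x j + m * s * j)"
  have finA: "finite A" using A finite_subset by blast
  have "f ` S \<subseteq> T"
  proof (clarsimp simp: S_def T_def f_def)
    fix s x j assume s: "s \<le> R" and x: "x \<in> {Suc 0..M} \<rightarrow>\<^sub>E A" and j: "Suc 0 \<le> j" "j \<le> M"
    have "x j \<in> A" using x j by auto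
    then have "x j \<in> {1..L}" using A by blast
    moreover have "m * s * j \<le> m * R * M" using s j by (intro mult_mono) auto
    then have "m * s * j < L" using L by (metis le_less_trans mult.assoc mult.commute)
    ultimately show "Suc 0 \<le> x j + m * s * j \<and> x j + m * s * j \<le> 2 * L"
      by auto
  qed
  moreover have "card T < card S"
  proof -
    have cardS: "card S = Suc R * card A ^ M"
      by (simp add: S_def card_cartesian_product card_PiE)
    have "0 < card A" using L dense by (cases "card A") auto
    have "card T = (2 * L) ^ M" by (simp add: T_def card_PiE)
    also have "\<dots> \<le> (2 * (r * card A)) ^ M" using dense by (intro power_mono) auto
    also have "\<dots> = (2 * r) ^ M * card A ^ M" by (simp add: power_mult_distrib mult.assoc)
    also have "\<dots> \<le> R * card A ^ M" using R by simp
    also have "\<dots> < card S" using \<open>0 < card A\<close> by (simp add: cardS)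
    finally show ?thesis .
  qed
  moreover have "finite T" by (simp add: T_def finite_PiE)
  ultimately have "\<not> inj_on f S" by (metis card_inj_on_le not_le)
  then obtain s x t y where st: "(s, x) \<in> S" "(t, y) \<in> S" "f (s, x) = f (t, y)" "(s, x) \<noteq> (t, y)"
    unfolding inj_on_def by fast
  have eq: "x j + m * s * j = y j + m * t * j" if "j \<in> {1..M}" for j
    using fun_cong[OF st(3), of j] that by (simp add: f_def)
  have "s \<noteq> t"
  proof
    assume "s = t"
    then have "x = y" using st(1,2) eq unfolding S_def by (intro PiE_ext[of x "{1..M}" "\<lambda>_. A"]) auto
    then show False using \<open>s = t\<close> st(4) by simp
  qed
  \<comment> \<open>The common dilation factor is \<open>t - s\<close>, with \<open>y j\<close> the
    smaller element of the pair; by symmetry the order \<open>s < t\<close> may be assumed.\<close>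
  have main: "\<exists>e\<in>{1..R}. \<forall>j\<in>{1..M}. \<exists>x\<in>A. x + m * e * j \<in> A"
    if "(s, x) \<in> S" "(t, y) \<in> S" "s < t"
      and eq: "\<And>j. j \<in> {1..M} \<Longrightarrow> x j + m * s * j = y j + m * t * j" for s t x y
  proof (rule bexI[of _ "t - s"], rule ballI)
    fix j assume j: "j \<in> {1..M}"
    have "t = s + (t - s)" using \<open>s < t\<close> by simp
    then have "m * t * j = m * s * j + m * (t - s) * j" by (metis distrib_left distrib_right)
    then have "y j + m * (t - s) * j = x j" using eq[OF j] by simp
    moreover have "y j \<in> A" "x j \<in> A" using that(1,2) j by (auto simp: S_def)
    ultimately show "\<exists>x\<in>A. x + m * (t - s) * j \<in> A" by metis
  qed (use that in \<open>auto simp: S_def\<close>)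
  show ?thesis
    using main[of s x t y] main[of t y s x] st(1,2) \<open>s \<noteq> t\<close> eq by (metis nat_neq_iff)
qed

lemma exists_large_fibre:
  assumes "finite X" "X \<noteq> {}"
  shows "\<exists>v\<in>f ` X. card X \<le> card (f ` X) * card {x \<in> X. f x = v}"
proof (rule ccontr)
  let ?F = "\<lambda>v. card {x \<in> X. f x = v}"
  assume "\<not> ?thesis"
  then have *: "card (f ` X) * ?F v < card X" if "v \<in> f ` X" for v using that by (meson not_le)
  have "card X = (\<Sum>v\<in>f ` X. ?F v)"
    using sum.image_gen[OF assms(1), of "\<lambda>_. 1::nat" f] by simp
  then have "card (f ` X) * card X = (\<Sum>v\<in>f ` X. card (f ` X) * ?F v)"
    by (simp add: sum_distrib_left)
  also have "\<dots> < (\<Sum>v\<in>f ` X. card X)"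
    using assms * by (intro sum_strict_mono) auto
  finally show False by simp
qed

text \<open>Induction on the number \<open>r\<close> of colours. The interval has to be finite
  because the recursion sees only a finite dilate of \<open>{1..M}\<close>. The pattern parametrises
  \<open>n * (k' - k) = m * w\<close> by \<open>k' = k + m * e\<close>,
  \<open>w = n * e\<close>.\<close>

lemma brauer_type_finite:
  fixes m n r :: nat
  assumes "n > 0"
  shows "\<exists>N. \<forall>c :: nat \<Rightarrow> 'a. card (c ` {1..N}) \<le> r \<longrightarrow>
           (\<exists>k>0. \<exists>e>0. c k = c (k + m * e) \<and> c k = c (n * e))"
proof (induction r)
  case 0
  show ?case by (rule exI[of _ 1]) auto
next
  case (Suc r)
  then obtain M where M: "\<And>c :: nat \<Rightarrow> 'a. card (c ` {1..M}) \<le> r \<Longrightarrow>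
      \<exists>k>0. \<exists>e>0. c k = c (k + m * e) \<and> c k = c (n * e)" by blast
  \<comment> \<open>\<open>R\<close> and \<open>L\<close> are what the dilation lemma asks of a
    class of density \<open>1 / Suc r\<close>; \<open>N\<close> covers both \<open>{1..L}\<close>
    and every \<open>n * e * j\<close> with \<open>e \<le> R\<close>,
    \<open>j \<le> M\<close>.\<close>
  define R where "R = (2 * Suc r) ^ M"
  define L where "L = Suc (m * M * R)"
  define N where "N = max L (n * R * M)"
  show ?case
  proof (rule exI[of _ N], intro allI impI)
    fix c :: "nat \<Rightarrow> 'a"
    assume c: "card (c ` {1..N}) \<le> Suc r"
    obtain v where v: "v \<in> c ` {1..L}"
      and large: "card {1..L} \<le> card (c ` {1..L}) * card {x \<in> {1..L}. c x = v}"
      using exists_large_fibre[of "{1..L}" c] by (auto simp: L_def)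
    define A where "A = {x \<in> {1..L}. c x = v}"
    have "card (c ` {1..L}) \<le> card (c ` {1..N})"
      by (intro card_mono image_mono) (auto simp: N_def)
    then have "card (c ` {1..L}) * card A \<le> Suc r * card A" using c by (intro mult_right_mono) auto
    then have "L \<le> Suc r * card A" using large by (simp add: A_def)
    moreover have "A \<subseteq> {1..L}" "m * M * R < L" "(2 * Suc r) ^ M \<le> R"
      by (auto simp: A_def L_def R_def)
    ultimately obtain e where e: "e \<in> {1..R}"
      and diff: "\<And>j. j \<in> {1..M} \<Longrightarrow> \<exists>x\<in>A. x + m * e * j \<in> A"
      using dilate_in_differences[of A L "Suc r" m M R] by blast
    show "\<exists>k>0. \<exists>e>0. c k = c (k + m * e) \<and> c k = c (n * e)"
    proof (cases "\<exists>j\<in>{1..M}. c (n * e * j) = v")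
      case True
      then obtain j where j: "j \<in> {1..M}" "c (n * e * j) = v" by blast
      obtain x where "x \<in> A" "x + m * e * j \<in> A" using diff[OF j(1)] by blast
      then show ?thesis using j e
        by (intro exI[of _ x] exI[of _ "e * j"] conjI) (auto simp: A_def mult.assoc)
    next
      case False
      \<comment> \<open>The dilate by \<open>n * e\<close> avoids the colour \<open>v\<close>, so
        the induced colouring of \<open>{1..M}\<close> has at most \<open>r\<close> colours.\<close>
      have "(\<lambda>j. c (n * e * j)) ` {1..M} \<subseteq> c ` {1..N} - {v}"
      proof (rule image_subsetI)
        fix j assume j: "j \<in> {1..M}"
        have "n * e * j \<le> n * R * M" using e j by (intro mult_mono) auto
        then have "n * e * j \<le> N" unfolding N_def by (rule max.coboundedI2)
        then have "n * e * j \<in> {1..N}" using e j assms by simp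
        then show "c (n * e * j) \<in> c ` {1..N} - {v}" using False j by blast
      qed
      then have "card ((\<lambda>j. c (n * e * j)) ` {1..M}) \<le> card (c ` {1..N} - {v})"
        by (intro card_mono) auto
      also have "v \<in> c ` {1..N}" using v by (auto simp: N_def)
      then have "card (c ` {1..N} - {v}) \<le> r" using c by simp
      finally obtain k d where "k > 0" "d > 0" "c (n * e * k) = c (n * e * (k + m * d))"
        "c (n * e * k) = c (n * e * (n * d))"
        using M[of "\<lambda>j. c (n * e * j)"] by blast
      \<comment> \<open>The pattern is homogeneous: multiplying \<open>k\<close> and
        \<open>d\<close> by \<open>n * e\<close> carries it back to \<open>c\<close>.\<close>
      then show ?thesis using e assms
        by (intro exI[of _ "n * e * k"] conjI exI[of _ "n * e * d"]) (auto simp: distrib_left mult_ac)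
    qed
  qed
qed

lemma brauer_type:
  fixes c :: "nat \<Rightarrow> 'a" and m n :: nat
  assumes "n > 0" and "finite (c ` {0<..})"
  obtains k e where "k > 0" "e > 0" "c k = c (k + m * e)" "c k = c (n * e)"
proof -
  obtain N where N: "\<And>c' :: nat \<Rightarrow> 'a. card (c' ` {1..N}) \<le> card (c ` {0<..}) \<Longrightarrow>
      \<exists>k>0. \<exists>e>0. c' k = c' (k + m * e) \<and> c' k = c' (n * e)"
    using brauer_type_finite[OF assms(1)] by metis
  have "card (c ` {1..N}) \<le> card (c ` {0<..})"
    using assms(2) by (intro card_mono) auto
  then show thesis using N[of c] that by blast
qed

section \<open>Valuations of rational numbers\<close>

text \<open>Makes the valuation computable from any fraction: cross-multiplying with the reduced one
  gives \<open>a * v = u * b\<close>, and multiplicities add.\<close>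

lemma padic_val_divide_of_int:
  assumes "prime p" "a \<noteq> 0" "b \<noteq> 0"
  shows "padic_val p (of_int a / of_int b)
       = int (multiplicity (int p) a) - int (multiplicity (int p) b)"
proof -
  obtain u v where uv: "quotient_of (of_int a / of_int b) = (u, v)" by fastforce
  have p: "prime_elem (int p)" using assms(1) by simp
  have v: "v > 0" using quotient_of_denom_pos[OF uv] .
  have eq: "(of_int a / of_int b :: rat) = of_int u / of_int v" using quotient_of_div[OF uv] .
  then have "(of_int (a * v) :: rat) = of_int (u * b)" using assms v by (simp add: field_simps)
  then have av: "a * v = u * b" using of_int_eq_iff by blast
  then have "u \<noteq> 0" using assms v by auto
  then have "multiplicity (int p) a + multiplicity (int p) v
      = multiplicity (int p) u + multiplicity (int p) b"
    using arg_cong[OF av, of "multiplicity (int p)"] assms v p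
    by (simp add: prime_elem_multiplicity_mult_distrib)
  then show ?thesis by (simp add: padic_val_def uv)
qed

lemma padic_val_of_int:
  assumes "prime p" "a \<noteq> 0"
  shows "padic_val p (of_int a) = int (multiplicity (int p) a)"
  using padic_val_divide_of_int[OF assms, of 1] by simp

lemma rat_as_fraction_nonzero:
  fixes r :: rat
  assumes "r \<noteq> 0"
  obtains a b where "a \<noteq> 0" "b \<noteq> 0" "r = of_int a / of_int b"
proof -
  obtain u v where "quotient_of r = (u, v)" by fastforce
  then show thesis using quotient_of_div quotient_of_denom_pos assms that[of u v] by force
qed

lemma padic_val_mult:
  assumes "prime p" "r \<noteq> 0" "s \<noteq> 0"
  shows "padic_val p (r * s) = padic_val p r + padic_val p s"
proof -
  obtain a b where r: "a \<noteq> 0" "b \<noteq> 0" "r = of_int a / of_int b"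
    using rat_as_fraction_nonzero[OF assms(2)] .
  obtain c d where s: "c \<noteq> 0" "d \<noteq> 0" "s = of_int c / of_int d"
    using rat_as_fraction_nonzero[OF assms(3)] .
  have "r * s = of_int (a * c) / of_int (b * d)" using r s by simp
  then show ?thesis using r s assms(1)
    by (simp add: padic_val_divide_of_int prime_elem_multiplicity_mult_distrib
        del: of_int_mult)
qed

lemma padic_val_1 [simp]: "prime p \<Longrightarrow> padic_val p 1 = 0"
  using padic_val_of_int[of p 1] by simp

lemma padic_val_inverse:
  assumes "prime p" "r \<noteq> 0"
  shows "padic_val p (inverse r) = - padic_val p r"
  using padic_val_mult[OF assms, of "inverse r"] assms by simp

lemma padic_val_power:
  assumes "prime p" "r \<noteq> 0"
  shows "padic_val p (r ^ k) = int k * padic_val p r"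
  using assms by (induction k) (simp_all add: padic_val_mult algebra_simps)

lemma padic_val_power_int:
  assumes "prime p" "r \<noteq> 0"
  shows "padic_val p (r powi k) = k * padic_val p r"
  using assms by (cases "k \<ge> 0") (simp_all add: power_int_def padic_val_power padic_val_inverse)

section \<open>The two implications\<close>

lemma frac_power_in_Q_if_partition_regular:
  fixes m n a b :: int
  assumes "n \<noteq> 0" "b \<noteq> 0"
    and pr: "partition_regular3 (\<lambda>x y z. (of_int a :: rat) powi n * of_nat x powi n * of_nat z powi m
        = of_int b powi n * of_nat y powi n)" (is "partition_regular3 ?E")
  shows "frac_power_in_Q m n (of_int a / of_int b)"
proof -
  \<comment> \<open>A constant colouring yields some solution; its right-hand side is nonzero, which
    excludes \<open>a = 0\<close>.\<close>
  have "\<exists>x>0. \<exists>y>0. \<exists>z>0. ?E x y z"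
    using pr[unfolded partition_regular3_def, rule_format, of "\<lambda>_. 0"]
    by (auto simp: image_constant_conv)
  then have "a \<noteq> 0" using assms(1,2) by (auto simp: power_int_0_left_if)
  moreover have "m dvd n * padic_val p (of_int a / of_int b)" if p: "prime p" for p
  proof -
    define v where "v = padic_val p (of_int a / of_int b)"
    define w where "w = (\<lambda>x::nat. multiplicity (int p) (int x))"
    define N where "N = (if m = 0 then nat \<bar>v\<bar> + 1 else nat \<bar>m\<bar>)"
    have "N > 0" by (simp add: N_def)
    have "finite ((\<lambda>x. w x mod N) ` {0<..})"
      by (rule finite_subset[of _ "{..<N}"]) (use \<open>N > 0\<close> in auto)
    then obtain x y z where xyz: "x > 0" "y > 0" "z > 0" "w x mod N = w y mod N" "?E x y z"
      using pr[unfolded partition_regular3_def, rule_format, of "\<lambda>x. w x mod N"] by blast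
    have val: "padic_val p (of_nat t) = int (w t)" if "t > 0" for t
      using padic_val_of_int[OF p, of "int t"] that by (simp add: w_def)
    have v: "v = padic_val p (of_int a) - padic_val p (of_int b)"
      using p \<open>a \<noteq> 0\<close> \<open>b \<noteq> 0\<close> by (simp add: v_def padic_val_divide_of_int padic_val_of_int)
    have "n * padic_val p (of_int a) + n * int (w x) + m * int (w z)
        = n * padic_val p (of_int b) + n * int (w y)"
      using arg_cong[OF xyz(5), of "padic_val p"] p xyz(1-3) \<open>a \<noteq> 0\<close> \<open>b \<noteq> 0\<close>
      by (simp add: padic_val_mult padic_val_power_int val)
    then have nv: "n * v = n * (int (w y) - int (w x)) - m * int (w z)"
      by (simp add: v algebra_simps)
    have "int (w y) mod int N = int (w x) mod int N"
      using xyz(4) by (simp flip: zmod_int)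
    then have N: "int N dvd int (w y) - int (w x)" by (simp add: mod_eq_dvd_iff)
    show ?thesis
    proof (cases "m = 0")
      case True
      then have "v = int (w y) - int (w x)" using nv \<open>n \<noteq> 0\<close> by simp
      then have "\<bar>v\<bar> + 1 dvd v" using N True by (simp add: N_def add.commute)
      then have "v = 0" using zdvd_imp_le[of "\<bar>v\<bar> + 1" "\<bar>v\<bar>"] by fastforce
      then show ?thesis by (simp flip: v_def)
    next
      case False
      then have "m dvd int (w y) - int (w x)" using N by (simp add: N_def)
      then show ?thesis using nv by (simp flip: v_def)
    qed
  qed
  ultimately show ?thesis using \<open>b \<noteq> 0\<close> by (simp add: frac_power_in_Q_def)
qed

lemma partition_regular_if_power_eq:
  fixes m n :: int and A B :: rat and l :: nat
  assumes "n \<noteq> 0" "B \<noteq> 0" "l > 0" and l: "(A / B) powi n = of_nat l powi m"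
  shows "partition_regular3 (\<lambda>x y z. A powi n * of_nat x powi n * of_nat z powi m
        = B powi n * of_nat y powi n)" (is "partition_regular3 ?E")
  unfolding partition_regular3_def
proof (intro allI impI)
  fix c :: "nat \<Rightarrow> nat"
  assume fin: "finite (c ` {0<..})"
  have E: "?E (l ^ (k - 1)) (l ^ (k' - 1)) (l ^ (w - 1))"
    if "k > 0" "k' > 0" "w > 0" "n * (int k' - int k) = m * int w" for k k' w
  proof -
    let ?l = "of_nat l :: rat"
    \<comment> \<open>For \<open>i > 0\<close> the truncated subtraction is genuine, so exponents
      can be handled in the integers.\<close>
    have pw: "(of_nat (l ^ (i - 1)) :: rat) = ?l powi (int i - 1)" if "i > 0" for i
    proof -
      have "int i - 1 = int (i - 1)" using that by simp
      then show ?thesis by (simp only: power_int_of_nat of_nat_power)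
    qed
    have A: "A powi n = B powi n * ?l powi m"
      using l \<open>B \<noteq> 0\<close> by (simp add: power_int_divide_distrib field_simps)
    have l0: "?l \<noteq> 0" using \<open>l > 0\<close> by simp
    \<comment> \<open>The leading \<open>m\<close> comes from the coefficient
      \<open>(A / B) powi n\<close> and cancels the shift in \<open>w - 1\<close>; the shifts of
      \<open>k\<close> and \<open>k'\<close> cancel each other.\<close>
    have ex: "m + (int k - 1) * n + (int w - 1) * m = (int k' - 1) * n"
      using that(4) by (simp add: algebra_simps)
    have "?l powi m * ?l powi ((int k - 1) * n) * ?l powi ((int w - 1) * m)
        = ?l powi ((int k' - 1) * n)"
      using l0 by (simp flip: ex add: power_int_add)
    then show ?thesis
      unfolding A pw[OF that(1)] pw[OF that(2)] pw[OF that(3)] power_int_mult[symmetric]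
      by (simp add: mult.assoc)
  qed
  have "finite ((\<lambda>k. c (l ^ (k - 1))) ` {0<..})"
    by (rule finite_subset[OF _ fin]) (use \<open>l > 0\<close> in auto)
  moreover have "nat \<bar>n\<bar> > 0" using \<open>n \<noteq> 0\<close> by simp
  \<comment> \<open>The exponents are coloured through \<open>k \<mapsto> l ^ (k - 1)\<close>, with
    absolute values as coefficients.\<close>
  ultimately obtain k e where ke: "k > 0" "e > 0"
      "c (l ^ (k - 1)) = c (l ^ (k + nat \<bar>m\<bar> * e - 1))"
      "c (l ^ (k - 1)) = c (l ^ (nat \<bar>n\<bar> * e - 1))"
    using brauer_type[of "nat \<bar>n\<bar>" "\<lambda>k. c (l ^ (k - 1))" "nat \<bar>m\<bar>"] by blast
  define k' where "k' = k + nat \<bar>m\<bar> * e"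
  define w where "w = nat \<bar>n\<bar> * e"
  have pos: "k' > 0" "w > 0" using ke \<open>n \<noteq> 0\<close> by (auto simp: k'_def w_def)
  \<comment> \<open>The first equation holds when \<open>m\<close> and \<open>n\<close> have the
    same sign; for opposite signs \<open>x\<close> and \<open>y\<close> exchange their
    roles.\<close>
  have "n * (int k' - int k) = m * int w \<or> n * (int k - int k') = m * int w"
    by (cases "m \<ge> 0"; cases "n \<ge> 0") (auto simp: k'_def w_def algebra_simps)
  then have "?E (l ^ (k - 1)) (l ^ (k' - 1)) (l ^ (w - 1))
      \<or> ?E (l ^ (k' - 1)) (l ^ (k - 1)) (l ^ (w - 1))"
    using E ke(1) pos by blast
  moreover have "l ^ i > 0" for i using \<open>l > 0\<close> by simp
  ultimately show "\<exists>x>0. \<exists>y>0. \<exists>z>0. c x = c y \<and> c y = c z \<and> ?E x y z"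
    using ke(3,4) unfolding k'_def[symmetric] w_def[symmetric] by metis
qed

theorem theorem4p9:
  fixes m n a b :: int
  assumes "n \<noteq> 0" and "b \<noteq> 0" and "gcd m n = 1" and "gcd a b = 1"
  defines "E \<equiv> (\<lambda>x y z :: nat.
      (of_int a :: rat) powi n * of_nat x powi n * of_nat z powi m
        = of_int b powi n * of_nat y powi n)"
  shows "(partition_regular3 E \<longrightarrow> frac_power_in_Q m n (of_int a / of_int b))
       \<and> (frac_power_in_N m n (of_int a / of_int b) \<longrightarrow> partition_regular3 E)"
  using frac_power_in_Q_if_partition_regular[OF assms(1,2), of a m]
    partition_regular_if_power_eq[OF assms(1), of "of_int b" _ "of_int a" m] assms(2)
  unfolding E_def frac_power_in_N_def by auto

end
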